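(* Let $r>1$ and let $S$ be an $F_r$-set (a right act over the free group $F_r$) generated by a finite set $A$, with growth function $g=g_{A,S}$. Write $g(n)=\alpha(n)(2r-1)^n$. Then $\alpha(n)$ converges to a limit $C_0$ as $n\to\infty$, and the growth of $S$ is maximal if and only if $C_0>0$. The same claim holds for the growth function of a finitely generated right module (with respect to a finite generating set) over the free group algebra $\mathcal{F}_r=\Phi F_r$, $r>1$, over a field $\Phi$.
   Context: $F_r$ is the free group with a fixed free basis $X$ of $r$ elements ($r$ finite), and $\mathcal{F}_r=\Phi F_r$ is its group algebra over a field $\Phi$. Acts and modules are right. $F(n)$ denotes the set of elements of $F_r$ whose reduced word in $X\cup X^{-1}$ has length at most $n$, and $\mathcal{F}(n)$ is the linear span of $F(n)$ in $\mathcal{F}_r$. For an $F_r$-set $S$ with finite generating set $A$ the growth function is $g_{A,S}(n)=\#(A\,F(n))$; for a module $M$ with finite generating set $A$ it is $g_{A,M}(n)=\dim_\Phi(A\,\mathcal{F}(n))$, where $A\,\mathcal{F}(n)$ is the span of all $av$, $a\in A$, $v\in\mathcal{F}(n)$. Two nondecreasing functions $f,g$ on $\{0,1,2,\dots\}$ are equivalent if there are nonnegative integers $C,C'$ with $f(n)\le g(n+C)$ and $g(n)\le f(n+C')$ for all $n\ge0$. The equivalence class of the growth function does not depend on the finite generating set and is called the growth. The growth of a finitely generated $F_r$-set (module) is called maximal if it equals the growth of the free $F_r$-set (free module) of rank 1, i.e. the growth function is equivalent to $(2r-1)^n$. *)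

theory Defs
  imports Complex_Main "HOL-Library.Poly_Mapping" "HOL-Library.Cardinality"
begin

text \<open>
  A letter \<open>(x, True)\<close> stands for the generator \<open>x\<close>, and \<open>(x, False)\<close> for its inverse.
  The group is written additively (class \<^class>\<open>group_add\<close>, which is not commutative), because
  \<^typ>\<open>'g \<Rightarrow>\<^sub>0 'k\<close> carries the convolution product of the group algebra exactly when
  \<^typ>\<open>'g\<close> is an additive monoid.
\<close>

type_synonym 'x letter = "'x \<times> bool"

definition inv_letter :: "'x letter \<Rightarrow> 'x letter"
  where "inv_letter l = (fst l, \<not> snd l)"

fun reduced :: "'x letter list \<Rightarrow> bool" where
  "reduced (l # m # w) \<longleftrightarrow> m \<noteq> inv_letter l \<and> reduced (m # w)"
| "reduced _ \<longleftrightarrow> True"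

text \<open>Left multiplication of a reduced word by one letter, followed by cancellation.\<close>

fun cons_letter :: "'x letter \<Rightarrow> 'x letter list \<Rightarrow> 'x letter list" where
  "cons_letter l [] = [l]"
| "cons_letter l (m # w) = (if m = inv_letter l then w else l # m # w)"

definition mult_word :: "'x letter list \<Rightarrow> 'x letter list \<Rightarrow> 'x letter list"
  where "mult_word u v = foldr cons_letter u v"

definition inv_word :: "'x letter list \<Rightarrow> 'x letter list"
  where "inv_word w = rev (map inv_letter w)"

lemma inv_letter_inv_letter [simp]: "inv_letter (inv_letter l) = l"
  by (simp add: inv_letter_def)

lemma inv_letter_neq [simp]: "inv_letter l \<noteq> l" "l \<noteq> inv_letter l"
  by (auto simp: inv_letter_def prod_eq_iff)

lemma inv_letter_eq_iff [simp]: "inv_letter l = inv_letter m \<longleftrightarrow> l = m"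
  by (metis inv_letter_inv_letter)

lemma reduced_tl: "reduced (l # w) \<Longrightarrow> reduced w"
  by (cases w) auto

lemma reduced_cons_letter: "reduced w \<Longrightarrow> reduced (cons_letter l w)"
  by (cases w) (auto dest: reduced_tl)

lemma reduced_mult_word: "reduced v \<Longrightarrow> reduced (mult_word u v)"
  unfolding mult_word_def by (induction u) (auto intro: reduced_cons_letter)

lemma cons_letter_cancel:
  assumes "reduced w"
  shows "cons_letter (inv_letter l) (cons_letter l w) = w"
proof (cases w)
  case (Cons m v)
  then show ?thesis using assms by (cases v) auto
qed simp

lemma cons_letter_cancel':
  assumes "reduced w"
  shows "cons_letter l (cons_letter (inv_letter l) w) = w"
  using cons_letter_cancel[OF assms, of "inv_letter l"] by simp

lemma mult_word_cons_letter:
  assumes "reduced w"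
  shows "mult_word (cons_letter l t) w = cons_letter l (mult_word t w)"
proof (cases t)
  case (Cons m v)
  then show ?thesis
    using cons_letter_cancel'[OF reduced_mult_word[OF assms, of v], of l]
    by (auto simp: mult_word_def)
qed (simp add: mult_word_def)

lemma mult_word_assoc:
  assumes "reduced w"
  shows "mult_word (mult_word u v) w = mult_word u (mult_word v w)"
proof (induction u)
  case (Cons l u)
  have "mult_word (mult_word (l # u) v) w = cons_letter l (mult_word (mult_word u v) w)"
    using mult_word_cons_letter[OF assms] by (simp add: mult_word_def)
  then show ?case by (simp add: Cons.IH) (simp add: mult_word_def)
qed (simp add: mult_word_def)

lemma cons_letter_reduced: "reduced (l # w) \<Longrightarrow> cons_letter l w = l # w"
  by (cases w) auto

lemma mult_word_Nil_right: "reduced u \<Longrightarrow> mult_word u [] = u"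
proof (induction u)
  case (Cons l u)
  then show ?case
    using reduced_tl[OF Cons.prems] cons_letter_reduced[OF Cons.prems]
    by (simp add: mult_word_def)
qed (simp add: mult_word_def)

lemma reduced_append_single:
  "reduced (w @ [l]) \<longleftrightarrow> reduced w \<and> (w = [] \<or> l \<noteq> inv_letter (last w))"
  by (induction w rule: reduced.induct) auto

lemma reduced_inv_word: "reduced w \<Longrightarrow> reduced (inv_word w)"
proof (induction w)
  case (Cons l w)
  then show ?case
    using reduced_tl[OF Cons.prems]
    using Cons.IH reduced_append_single[of "inv_word w" "inv_letter l"]
    by (cases w) (auto simp: inv_word_def)
qed (simp add: inv_word_def)

lemma mult_word_inv_word_left: "reduced w \<Longrightarrow> mult_word (inv_word w) w = []"
proof (induction w)
  case (Cons l w)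
  have "mult_word (inv_word (l # w)) (l # w)
      = mult_word (inv_word w) (cons_letter (inv_letter l) (l # w))"
    by (simp add: mult_word_def inv_word_def)
  then show ?case using Cons.IH reduced_tl[OF Cons.prems] by simp
qed (simp add: mult_word_def inv_word_def)

typedef 'x free_group = "{w :: 'x letter list. reduced w}"
  morphisms reduced_word Abs_free_group
  by (rule exI[of _ "[]"]) simp

setup_lifting type_definition_free_group

instantiation free_group :: (type) group_add
begin

lift_definition zero_free_group :: "'a free_group" is "[]" by simp

lift_definition plus_free_group :: "'a free_group \<Rightarrow> 'a free_group \<Rightarrow> 'a free_group"
  is mult_word by (rule reduced_mult_word)

lift_definition uminus_free_group :: "'a free_group \<Rightarrow> 'a free_group"
  is inv_word by (rule reduced_inv_word)

definition minus_free_group :: "'a free_group \<Rightarrow> 'a free_group \<Rightarrow> 'a free_group"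
  where "minus_free_group u v = u + - v"

instance
proof
  fix a b c :: "'a free_group"
  show "a + b + c = a + (b + c)" by transfer (rule mult_word_assoc)
  show "0 + a = a" by transfer (simp add: mult_word_def)
  show "a + 0 = a" by transfer (rule mult_word_Nil_right)
  show "- a + a = 0" by transfer (rule mult_word_inv_word_left)
  show "a + - b = a - b" by (simp add: minus_free_group_def)
qed

end

definition word_ball :: "nat \<Rightarrow> 'x free_group set"
  where "word_ball n = {w. length (reduced_word w) \<le> n}"

definition growth_equiv :: "(nat \<Rightarrow> nat) \<Rightarrow> (nat \<Rightarrow> nat) \<Rightarrow> bool"
  where "growth_equiv f g \<longleftrightarrow>
    (\<exists>C C'. \<forall>n. f n \<le> g (n + C) \<and> g n \<le> f (n + C'))"

locale right_act =
  fixes S :: "'s set" and act :: "'s \<Rightarrow> 'g::group_add \<Rightarrow> 's"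
  assumes act_closed: "s \<in> S \<Longrightarrow> act s u \<in> S"
    and act_zero: "s \<in> S \<Longrightarrow> act s 0 = s"
    and act_plus: "s \<in> S \<Longrightarrow> act s (u + v) = act (act s u) v"

definition act_generates :: "'s set \<Rightarrow> ('s \<Rightarrow> 'g::group_add \<Rightarrow> 's) \<Rightarrow> 's set \<Rightarrow> bool"
  where "act_generates S act A \<longleftrightarrow> A \<subseteq> S \<and> S = {act a u | a u. a \<in> A}"

definition act_growth_fun :: "('s \<Rightarrow> 'x free_group \<Rightarrow> 's) \<Rightarrow> 's set \<Rightarrow> nat \<Rightarrow> nat"
  where "act_growth_fun act A n = card {act a u | a u. a \<in> A \<and> u \<in> word_ball n}"

text \<open>
  The growth is the equivalence class, among nondecreasing functions, of the growth function of
  any finite generating set.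
\<close>

definition act_growth :: "'s set \<Rightarrow> ('s \<Rightarrow> 'x free_group \<Rightarrow> 's) \<Rightarrow> (nat \<Rightarrow> nat) set"
  where "act_growth S act = {f. mono f \<and>
    (\<exists>A. finite A \<and> act_generates S act A \<and> growth_equiv f (act_growth_fun act A))}"

text \<open>The free act of rank 1 is the group acting on itself by right translations.\<close>

definition maximal_act_growth :: "'s set \<Rightarrow> ('s \<Rightarrow> 'x free_group \<Rightarrow> 's) \<Rightarrow> bool"
  where "maximal_act_growth S act \<longleftrightarrow>
    act_growth S act = act_growth UNIV ((+) :: 'x free_group \<Rightarrow> 'x free_group \<Rightarrow> 'x free_group)"

lemma right_act_regular: "right_act UNIV ((+) :: 'g::group_add \<Rightarrow> 'g \<Rightarrow> 'g)"
  by unfold_locales (simp_all add: add.assoc)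

type_synonym ('x, 'k) free_group_algebra = "'x free_group \<Rightarrow>\<^sub>0 'k"

locale right_module =
  fixes act :: "'m::ab_group_add \<Rightarrow> 'a::ring_1 \<Rightarrow> 'm"
  assumes act_add_left: "act (x + y) a = act x a + act y a"
    and act_add_right: "act x (a + b) = act x a + act x b"
    and act_one: "act x 1 = x"
    and act_mult: "act x (a * b) = act (act x a) b"

definition right_submodule :: "('m::ab_group_add \<Rightarrow> 'a::ring_1 \<Rightarrow> 'm) \<Rightarrow> 'm set \<Rightarrow> bool"
  where "right_submodule act N \<longleftrightarrow>
    0 \<in> N \<and> (\<forall>x\<in>N. \<forall>y\<in>N. x + y \<in> N) \<and> (\<forall>x\<in>N. \<forall>a. act x a \<in> N)"

definition module_generates :: "('m::ab_group_add \<Rightarrow> 'a::ring_1 \<Rightarrow> 'm) \<Rightarrow> 'm set \<Rightarrow> bool"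
  where "module_generates act A \<longleftrightarrow> right_submodule act hull A = UNIV"

text \<open>The vector space structure that a module over the group algebra inherits from the field.\<close>

definition field_scale ::
    "('m::ab_group_add \<Rightarrow> ('g::group_add \<Rightarrow>\<^sub>0 'k::field) \<Rightarrow> 'm) \<Rightarrow> 'k \<Rightarrow> 'm \<Rightarrow> 'm"
  where "field_scale act c x = act x (Poly_Mapping.single 0 c)"

lemma (in right_module) act_minus_right: "act x (a - b) = act x a - act x b"
  using act_add_right[of x "a - b" b] by (simp add: algebra_simps)

lemma right_module_regular: "right_module ((*) :: 'a::ring_1 \<Rightarrow> 'a \<Rightarrow> 'a)"
  by unfold_locales (simp_all add: algebra_simps)

lemma vector_space_field_scale:
  fixes act :: "'m::ab_group_add \<Rightarrow> ('g::group_add \<Rightarrow>\<^sub>0 'k::field) \<Rightarrow> 'm"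
  assumes "right_module act"
  shows "vector_space (field_scale act)"
proof -
  interpret right_module act by fact
  show ?thesis
  proof
    fix a b :: 'k and x y :: 'm
    show "field_scale act a (x + y) = field_scale act a x + field_scale act a y"
      by (simp add: field_scale_def act_add_left)
    show "field_scale act (a + b) x = field_scale act a x + field_scale act b x"
      by (simp add: field_scale_def single_add act_add_right)
    show "field_scale act a (field_scale act b x) = field_scale act (a * b) x"
      by (simp add: field_scale_def flip: act_mult) (simp add: mult_single mult.commute)
    show "field_scale act 1 x = x"
      by (simp add: field_scale_def act_one)
  qed
qed

definition algebra_ball :: "nat \<Rightarrow> ('x, 'k::field) free_group_algebra set"
  where "algebra_ball n =
    module.span (field_scale (*)) ((\<lambda>w. Poly_Mapping.single w 1) ` word_ball n)"

definition module_growth_fun ::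
    "('m::ab_group_add \<Rightarrow> ('x, 'k::field) free_group_algebra \<Rightarrow> 'm) \<Rightarrow> 'm set \<Rightarrow> nat \<Rightarrow> nat"
  where "module_growth_fun act A n = vector_space.dim (field_scale act)
    (module.span (field_scale act) {act a v | a v. a \<in> A \<and> v \<in> algebra_ball n})"

definition module_growth ::
    "('m::ab_group_add \<Rightarrow> ('x, 'k::field) free_group_algebra \<Rightarrow> 'm) \<Rightarrow> (nat \<Rightarrow> nat) set"
  where "module_growth act = {f. mono f \<and>
    (\<exists>A. finite A \<and> module_generates act A \<and> growth_equiv f (module_growth_fun act A))}"

definition maximal_module_growth ::
    "('m::ab_group_add \<Rightarrow> ('x, 'k::field) free_group_algebra \<Rightarrow> 'm) \<Rightarrow> bool"
  where "maximal_module_growth act \<longleftrightarrow>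
    module_growth act =
      module_growth ((*) :: ('x, 'k) free_group_algebra \<Rightarrow> _ \<Rightarrow> ('x, 'k) free_group_algebra)"

end

theory Submission
  imports Defs
begin

text \<open>
  Every element that first appears in \<open>A F(n+1)\<close> is sent back to \<open>A F(n)\<close> by at least one letter, so
  at most \<open>q = 2r - 1\<close> letters lead to something new, whence
  \<open>g (n+2) - g (n+1) \<le> q (g (n+1) - g n)\<close>. In the module case the same count is applied to elements
  of \<open>A F(n+1)\<close> that complete a basis of \<open>A \<F>(n)\<close> to one of \<open>A \<F>(n+1)\<close>. The inequality makes
  \<open>g n / q ^ n\<close> decreasing up to a summand that tends to \<open>0\<close>. The free objects of rank 1 grow at
  least like \<open>q ^ n\<close>, so their limit is positive, and equivalence with them amounts to \<open>C\<^sub>0 > 0\<close>.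
\<close>

section \<open>Sequences compared with a geometric one\<close>

text \<open>The hypothesis says exactly that \<open>g (n+1) - q * g n\<close> is nonincreasing in
  \<open>n\<close>, hence at most its value at \<open>0\<close>, hence at most \<open>g 1\<close>.
  So \<open>g n / q ^ n\<close> can increase at step \<open>n\<close> by at most
  \<open>g 1 / q ^ (n+1)\<close>, and these increments are summable.\<close>

lemma normalized_growth_convergent:
  fixes g :: "nat \<Rightarrow> nat" and q :: nat
  assumes "q > 1" and step: "\<And>n. g (Suc (Suc n)) + q * g n \<le> (q + 1) * g (Suc n)"
  shows "convergent (\<lambda>n. real (g n) / real q ^ n)"
proof -
  have bound: "g (Suc n) \<le> q * g n + g 1" for n
  proof (induction n)
    case (Suc n)
    then show ?case using step[of n] by simp
  qed simp
  \<comment> \<open>\<open>e n\<close> is the tail of the geometric series of possible increments,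
    the sum of \<open>g 1 / q ^ (k+1)\<close> over \<open>k \<ge> n\<close>. Adding it turns the
    almost decreasing sequence into a decreasing one.\<close>
  define e where "e n = real (g 1) / ((real q - 1) * real q ^ n)" for n
  define X where "X n = real (g n) / real q ^ n + e n" for n
  have q: "real q > 1" using assms(1) by simp
  have "decseq X"
  proof (rule decseq_SucI)
    fix n
    have "real (g (Suc n)) / real q ^ Suc n \<le> (real q * real (g n) + real (g 1)) / real q ^ Suc n"
      using bound[of n] q by (intro divide_right_mono) (auto simp flip: of_nat_mult of_nat_add)
    also have "\<dots> = real (g n) / real q ^ n + e n - e (Suc n)"
    proof -
      have "real (g 1) / (real q * real q ^ n) = e n - e (Suc n)"
        using q unfolding e_def by (simp add: divide_simps) (simp add: algebra_simps)
      then show ?thesis using q by (simp add: add_divide_distrib)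
    qed
    finally show "X (Suc n) \<le> X n" by (simp add: X_def)
  qed
  moreover have "\<forall>n. 0 \<le> X n"
    using q by (simp add: X_def e_def)
  ultimately obtain L where "X \<longlonglongrightarrow> L"
    by (metis decseq_convergent)
  moreover have "e \<longlonglongrightarrow> 0"
  proof -
    have "(\<lambda>n. (real (g 1) / (real q - 1)) * inverse (real q ^ n)) \<longlonglongrightarrow> real (g 1) / (real q - 1) * 0"
      by (intro tendsto_mult_left LIMSEQ_inverse_realpow_zero q)
    then show ?thesis by (simp add: e_def[abs_def] field_simps)
  qed
  ultimately have "(\<lambda>n. X n - e n) \<longlonglongrightarrow> L - 0"
    by (rule tendsto_diff)
  then show ?thesis by (auto simp: X_def convergent_def)
qed

text \<open>Convergence gives \<open>f n \<le> K * q ^ n\<close> for all \<open>n\<close>, and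
  \<open>b n > D/2 * q ^ n\<close> from some \<open>N\<close> on. A shift by \<open>M\<close>
  multiplies the lower bound by \<open>q ^ M\<close>, which beats the ratio of the constants; the
  further shift by \<open>N\<close> makes the lower bound available from
  \<open>n = 0\<close>.\<close>

lemma bounded_by_shift:
  fixes f b :: "nat \<Rightarrow> nat" and q :: nat
  assumes q: "q > 1" and f: "(\<lambda>n. real (f n) / real q ^ n) \<longlonglongrightarrow> L"
    and b: "(\<lambda>n. real (b n) / real q ^ n) \<longlonglongrightarrow> D" and "D > 0"
  shows "\<exists>C. \<forall>n. f n \<le> b (n + C)"
proof -
  have q': "real q > 1" using q by simp
  obtain K where K: "\<And>n. real (f n) / real q ^ n \<le> K"
    using convergent_imp_Bseq[OF convergentI[OF f]] unfolding Bseq_def by auto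
  obtain N where N: "\<And>n. n \<ge> N \<Longrightarrow> real (b n) / real q ^ n > D / 2"
    using order_tendstoD(1)[OF b, of "D / 2"] \<open>D > 0\<close> by (auto simp: eventually_sequentially)
  obtain M where M: "2 * K / D < real q ^ M"
    using real_arch_pow[OF q'] by blast
  have "f n \<le> b (n + (N + M))" for n
  proof -
    have "real (f n) \<le> K * real q ^ n"
      using K[of n] q' by (simp add: field_simps)
    also have "\<dots> \<le> (D / 2 * real q ^ M) * real q ^ n"
      using M \<open>D > 0\<close> q' by (intro mult_right_mono) (auto simp: field_simps)
    also have "\<dots> \<le> D / 2 * real q ^ (n + (N + M))"
      using q' \<open>D > 0\<close> by (simp add: power_add)
    also have "\<dots> \<le> real (b (n + (N + M)))"
      using N[of "n + (N + M)"] q' by (simp add: field_simps)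
    finally show ?thesis by simp
  qed
  then show ?thesis by blast
qed

text \<open>A shift by \<open>C\<close> costs only the factor \<open>q ^ C\<close> in the limit, so
  \<open>b n \<le> f (n + C)\<close> yields \<open>D \<le> q ^ C * L\<close>. Conversely, two
  positive limits allow a comparison by shifts in both directions.\<close>

lemma growth_equiv_iff_limit_pos:
  fixes f b :: "nat \<Rightarrow> nat" and q :: nat
  assumes q: "q > 1" and f: "(\<lambda>n. real (f n) / real q ^ n) \<longlonglongrightarrow> L"
    and b: "(\<lambda>n. real (b n) / real q ^ n) \<longlonglongrightarrow> D" and "D > 0"
  shows "growth_equiv f b \<longleftrightarrow> L > 0"
proof
  assume "growth_equiv f b"
  then obtain C where C: "\<And>n. b n \<le> f (n + C)"
    unfolding growth_equiv_def by blast
  have "(\<lambda>n. real q ^ C * (real (f (n + C)) / real q ^ (n + C))) \<longlonglongrightarrow> real q ^ C * L"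
    by (intro tendsto_mult_left LIMSEQ_ignore_initial_segment[OF f])
  moreover have "real (b n) / real q ^ n \<le> real q ^ C * (real (f (n + C)) / real q ^ (n + C))" for n
    using C[of n] q by (simp add: power_add field_simps)
  ultimately have "D \<le> real q ^ C * L"
    by (intro LIMSEQ_le[OF b]) auto
  with \<open>D > 0\<close> have "real q ^ C * L > 0" by linarith
  then show "L > 0" using q by (simp add: zero_less_mult_iff)
next
  assume "L > 0"
  then show "growth_equiv f b"
    using bounded_by_shift[OF q f b \<open>D > 0\<close>] bounded_by_shift[OF q b f]
    unfolding growth_equiv_def by blast
qed

lemma limit_pos_of_power_le:
  fixes b :: "nat \<Rightarrow> nat" and q :: nat
  assumes "q > 0" "\<And>n. q ^ n \<le> b n" "(\<lambda>n. real (b n) / real q ^ n) \<longlonglongrightarrow> D"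
  shows "D > 0"
proof -
  have "1 \<le> real (b n) / real q ^ n" for n
    using assms(1) of_nat_mono[OF assms(2)[of n], where 'a=real] by simp
  then have "1 \<le> D" using assms(3) by (intro LIMSEQ_le_const) auto
  then show ?thesis by simp
qed

section \<open>Equivalence of growth functions\<close>

lemma growth_equiv_refl: "growth_equiv f f"
  unfolding growth_equiv_def by (metis add.right_neutral order_refl)

lemma growth_equiv_sym: "growth_equiv f g \<Longrightarrow> growth_equiv g f"
  unfolding growth_equiv_def by blast

lemma growth_equiv_trans:
  assumes "growth_equiv f g" "growth_equiv g h"
  shows "growth_equiv f h"
proof -
  from assms obtain a b c d where
    "\<And>n. f n \<le> g (n + a)" "\<And>n. g n \<le> f (n + b)" "\<And>n. g n \<le> h (n + c)" "\<And>n. h n \<le> g (n + d)"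
    unfolding growth_equiv_def by blast
  then have "f n \<le> h (n + (a + c)) \<and> h n \<le> f (n + (d + b))" for n
    by (metis add.assoc order_trans)
  then show ?thesis unfolding growth_equiv_def by blast
qed

text \<open>A growth is a class that quantifies over all finite generating sets. Since the choice of
  generators is immaterial by \<open>G\<close> and \<open>H\<close>, equality of two classes can be
  tested on one representative each. Monotonicity is what puts \<open>g A\<close> into its own
  class. The predicates are abstract so that acts and modules are both covered.\<close>

lemma growth_class_eq_iff:
  assumes G: "\<And>A A'. P A \<Longrightarrow> P A' \<Longrightarrow> growth_equiv (g A) (g A')"
    and H: "\<And>A A'. Q A \<Longrightarrow> Q A' \<Longrightarrow> growth_equiv (h A) (h A')"
    and "P A" "Q B" "mono (g A)"
  shows "{f. mono f \<and> (\<exists>A. P A \<and> growth_equiv f (g A))} =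
         {f. mono f \<and> (\<exists>B. Q B \<and> growth_equiv f (h B))} \<longleftrightarrow> growth_equiv (g A) (h B)"
    (is "?L = ?R \<longleftrightarrow> _")
proof
  assume "?L = ?R"
  moreover have "g A \<in> ?L" using assms growth_equiv_refl by blast
  ultimately obtain B' where "Q B'" "growth_equiv (g A) (h B')" by blast
  then show "growth_equiv (g A) (h B)" using H \<open>Q B\<close> growth_equiv_trans by blast
next
  assume gh: "growth_equiv (g A) (h B)"
  show "?L = ?R"
  proof (intro Collect_cong conj_cong refl iffI)
    fix f assume "\<exists>A. P A \<and> growth_equiv f (g A)"
    then show "\<exists>B. Q B \<and> growth_equiv f (h B)"
      using G[OF _ \<open>P A\<close>] gh \<open>Q B\<close> growth_equiv_trans by blast
  next
    fix f assume "\<exists>B. Q B \<and> growth_equiv f (h B)"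
    then show "\<exists>A. P A \<and> growth_equiv f (g A)"
      using H[OF _ \<open>Q B\<close>] growth_equiv_sym[OF gh] \<open>P A\<close> growth_equiv_trans by blast
  qed
qed

text \<open>Here \<open>a\<close>, \<open>b\<close>, \<open>c\<close> stand for the sizes (or
  dimensions) at radius \<open>n+2\<close>, \<open>n+1\<close>, \<open>n\<close>, and
  \<open>u\<close> for the number of elements added last. The condition \<open>c \<le> b\<close>
  keeps the truncated subtraction honest.\<close>

lemma increment_bound:
  fixes a b c u q :: nat
  assumes "a \<le> b + u" "u \<le> q * (b - c)" "c \<le> b"
  shows "a + q * c \<le> (q + 1) * b"
proof -
  have "q * (b - c) + q * c = q * b"
    using assms(3) by (simp flip: distrib_left)
  then show ?thesis using assms(1,2) by simp
qed

section \<open>Balls in the free group\<close>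

lift_definition letter_elem :: "'x letter \<Rightarrow> 'x free_group" is "\<lambda>l. [l]" by simp

lemma letter_elem_add_inv: "letter_elem l + letter_elem (inv_letter l) = 0"
  by transfer (simp add: mult_word_def)

lemma mult_word_append: "reduced (u @ v) \<Longrightarrow> mult_word u v = u @ v"
proof (induction u)
  case (Cons l u)
  then show ?case
    using cons_letter_reduced[of l "u @ v"] reduced_tl[of l "u @ v"] by (simp add: mult_word_def)
qed (simp add: mult_word_def)

lemma length_cons_letter: "length (cons_letter l w) \<le> Suc (length w)"
  by (cases w) auto

lemma length_mult_word: "length (mult_word u v) \<le> length u + length v"
proof (induction u)
  case (Cons l u)
  then show ?case
    using length_cons_letter[of l "mult_word u v"] by (simp add: mult_word_def)
qed (simp add: mult_word_def)

lemma word_ball_add: "u \<in> word_ball m \<Longrightarrow> v \<in> word_ball n \<Longrightarrow> u + v \<in> word_ball (m + n)"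
  unfolding word_ball_def mem_Collect_eq plus_free_group.rep_eq
  using length_mult_word[of "reduced_word u" "reduced_word v"] by linarith

lemma word_ball_mono: "m \<le> n \<Longrightarrow> word_ball m \<subseteq> word_ball n"
  by (auto simp: word_ball_def)

lemma letter_elem_in_word_ball: "letter_elem l \<in> word_ball 1"
  by (simp add: word_ball_def letter_elem.rep_eq)

lemma zero_in_word_ball: "0 \<in> word_ball n"
  by (simp add: word_ball_def zero_free_group.rep_eq)

text \<open>The last letter of the reduced word is split off, not the first, because in a right act
  it is the last letter that acts last.\<close>

lemma word_ball_Suc_cases:
  assumes "u \<in> word_ball (Suc n)"
  obtains "u \<in> word_ball n" | v l where "v \<in> word_ball n" "u = v + letter_elem l"
proof (cases "u \<in> word_ball n")
  case False
  then have "reduced_word u \<noteq> []" by (auto simp: word_ball_def)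
  then obtain w l where w: "reduced_word u = w @ [l]"
    by (metis append_butlast_last_id)
  have red: "reduced (w @ [l])" using reduced_word[of u] w by simp
  then have rw: "reduced w" by (simp add: reduced_append_single)
  have "u = Abs_free_group w + letter_elem l"
    using red rw w mult_word_append[OF red]
    by (simp add: plus_free_group.rep_eq letter_elem.rep_eq Abs_free_group_inverse
        flip: reduced_word_inject)
  moreover have "Abs_free_group w \<in> word_ball n"
    using assms rw w by (simp add: word_ball_def Abs_free_group_inverse)
  ultimately show ?thesis using that by blast
qed

lemma finite_word_ball: "finite (word_ball n :: 'x::finite free_group set)"
proof (rule finite_imageD)
  show "finite (reduced_word ` (word_ball n :: 'x free_group set))"
    by (rule finite_subset[OF _ finite_lists_length_le[OF finite_class.finite_UNIV]])
      (auto simp: word_ball_def)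
qed (simp add: inj_on_def reduced_word_inject)

section \<open>Counting reduced words\<close>

lemma card_letters: "card (UNIV - {l :: 'x::finite letter}) = 2 * CARD('x) - 1"
  by (simp add: card_Diff_singleton)

lemma card_reduced_ge: "(2 * CARD('x::finite) - 1) ^ n \<le> card {w :: 'x letter list. reduced w \<and> length w = n}"
proof (induction n)
  case 0
  have "{w :: 'x letter list. reduced w \<and> length w = 0} = {[]}" by auto
  then show ?case by simp
next
  case (Suc n)
  let ?R = "\<lambda>n. {w :: 'x letter list. reduced w \<and> length w = n}"
  have fin: "finite (?R n)" for n
    by (rule finite_subset[OF _ finite_lists_length_le[OF finite_class.finite_UNIV, of n]]) auto
  \<comment> \<open>A reduced word is extended on the left by any letter that does not cancel
    against its head. For the empty word \<open>hd\<close> is unspecified, but every letter is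
    allowed there, so excluding one only loses a word; a lower bound is all that is wanted.\<close>
  define P where "P = (SIGMA w:?R n. UNIV - {inv_letter (hd w)})"
  have "(2 * CARD('x) - 1) ^ Suc n \<le> card (?R n) * (2 * CARD('x) - 1)"
    using Suc by simp
  also have "\<dots> = card P"
    using fin by (simp add: P_def card_letters)
  also have "\<dots> = card ((\<lambda>(w, l). l # w) ` P)"
    by (rule card_image[symmetric]) (auto simp: inj_on_def)
  also have "\<dots> \<le> card (?R (Suc n))"
  proof (rule card_mono[OF fin])
    have "reduced (l # w)" if "reduced w" "l \<noteq> inv_letter (hd w)" for l and w :: "'x letter list"
      using that by (cases w) auto
    then show "(\<lambda>(w, l). l # w) ` P \<subseteq> ?R (Suc n)" by (auto simp: P_def)
  qed
  finally show ?case .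
qed

lemma card_word_ball_ge: "(2 * CARD('x::finite) - 1) ^ n \<le> card (word_ball n :: 'x free_group set)"
proof -
  let ?R = "{w :: 'x letter list. reduced w \<and> length w = n}"
  have "card ?R = card (Abs_free_group ` ?R)"
    by (rule card_image[symmetric]) (auto simp: inj_on_def Abs_free_group_inject)
  also have "\<dots> \<le> card (word_ball n :: 'x free_group set)"
    by (rule card_mono[OF finite_word_ball]) (auto simp: word_ball_def Abs_free_group_inverse)
  finally show ?thesis using card_reduced_ge[of n, where 'x='x] by linarith
qed

section \<open>Acts\<close>

text \<open>This is the set \<open>A F(n)\<close>. It is used for modules as well, with group
  elements acting through \<open>translate\<close>.\<close>

definition act_ball :: "('s \<Rightarrow> 'x free_group \<Rightarrow> 's) \<Rightarrow> 's set \<Rightarrow> nat \<Rightarrow> 's set"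
  where "act_ball act A n = {act a u | a u. a \<in> A \<and> u \<in> word_ball n}"

lemma act_ballI: "a \<in> A \<Longrightarrow> u \<in> word_ball n \<Longrightarrow> act a u \<in> act_ball act A n"
  by (auto simp: act_ball_def)

lemma act_ball_mono: "m \<le> n \<Longrightarrow> act_ball act A m \<subseteq> act_ball act A n"
  using word_ball_mono[of m n] by (auto simp: act_ball_def)

text \<open>\<open>A\<close> is just a finite subset of \<open>S\<close>, so that the generators of
  a module fit too: they generate it as a module, not as an act of the group.\<close>

locale free_group_act = right_act S act
  for S :: "'s set" and act :: "'s \<Rightarrow> 'x::finite free_group \<Rightarrow> 's" +
  fixes A :: "'s set"
  assumes finite_A: "finite A" and A_subset: "A \<subseteq> S"
begin

abbreviation "gball \<equiv> act_ball act A"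

lemma finite_gball: "finite (gball n)"
proof -
  have "gball n = (\<lambda>(a, u). act a u) ` (A \<times> word_ball n)"
    by (auto simp: act_ball_def)
  then show ?thesis
    by (simp add: finite_A finite_word_ball)
qed

lemma gball_subset: "gball n \<subseteq> S"
  using A_subset act_closed by (auto simp: act_ball_def)

lemma gball_act:
  assumes "s \<in> gball n" "u \<in> word_ball m"
  shows "act s u \<in> gball (n + m)"
proof -
  from assms(1) obtain a v where "a \<in> A" "v \<in> word_ball n" "s = act a v"
    by (auto simp: act_ball_def)
  then show ?thesis
    using act_plus[of a v u] A_subset word_ball_add[OF _ assms(2), of v n]
    by (metis act_ballI subsetD)
qed

lemma gball_Suc_cases:
  assumes "s \<in> gball (Suc n)"
  obtains "s \<in> gball n" | t l where "t \<in> gball n" "s = act t (letter_elem l)"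
proof -
  from assms obtain a u where a: "a \<in> A" and u: "u \<in> word_ball (Suc n)" and s: "s = act a u"
    by (auto simp: act_ball_def)
  from u show ?thesis
  proof (cases rule: word_ball_Suc_cases)
    case 1
    with a s that show ?thesis by (auto simp: act_ball_def)
  next
    case (2 v l)
    then show ?thesis
      using that(2)[of "act a v" l] a s A_subset act_plus[of a v] by (auto simp: act_ball_def)
  qed
qed

text \<open>The element was reached from some \<open>t\<close> in the smaller ball by a letter
  \<open>l\<close>; the inverse letter leads back to \<open>t\<close>.\<close>

lemma gball_letter_back:
  assumes "s \<in> gball (Suc n) - gball n"
  shows "\<exists>l. act s (letter_elem l) \<in> gball n"
proof -
  from assms obtain t l where t: "t \<in> gball n" and s: "s = act t (letter_elem l)"
    using gball_Suc_cases by blast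
  have "t \<in> S" using t gball_subset by blast
  then have "act s (letter_elem (inv_letter l)) = t"
    using act_plus[of t "letter_elem l" "letter_elem (inv_letter l)"]
    by (simp add: s letter_elem_add_inv act_zero)
  then show ?thesis using t by blast
qed

text \<open>Of the \<open>2r\<close> letters, one takes an element of \<open>T\<close> back into the
  ball of radius \<open>n\<close>, so at most \<open>2r - 1\<close> images per element can be new;
  \<open>U\<close> collects the images under these letters. \<open>T\<close> is arbitrary because
  acts need the whole difference of two balls, while modules need only the part of a basis lying in
  it.\<close>

lemma new_elements:
  assumes T: "T \<subseteq> gball (Suc n) - gball n"
  obtains U where "finite U" "card U \<le> (2 * CARD('x) - 1) * card T"
    "\<And>s l. s \<in> T \<Longrightarrow> act s (letter_elem l) \<in> gball (Suc n) \<union> U"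
proof -
  have fin: "finite T" using T finite_gball finite_subset by blast
  have "\<forall>s\<in>T. \<exists>l. act s (letter_elem l) \<in> gball n"
    using T gball_letter_back by blast
  then obtain ret where ret: "\<And>s. s \<in> T \<Longrightarrow> act s (letter_elem (ret s)) \<in> gball n"
    by metis
  define P where "P = (SIGMA s:T. UNIV - {ret s})"
  have "finite P" using fin by (simp add: P_def)
  define U where "U = (\<lambda>(s, l). act s (letter_elem l)) ` P"
  show ?thesis
  proof (rule that)
    show "finite U" using \<open>finite P\<close> by (simp add: U_def)
    have "card U \<le> card P" unfolding U_def by (rule card_image_le[OF \<open>finite P\<close>])
    also have "\<dots> = (2 * CARD('x) - 1) * card T" using fin by (simp add: P_def card_letters)
    finally show "card U \<le> (2 * CARD('x) - 1) * card T" .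
    show "act s (letter_elem l) \<in> gball (Suc n) \<union> U" if "s \<in> T" for s l
    proof (cases "l = ret s")
      case True
      then show ?thesis using ret[OF that] act_ball_mono[of n "Suc n" act A] by auto
    next
      case False
      then have "(s, l) \<in> P" using that by (simp add: P_def)
      then show ?thesis unfolding U_def by force
    qed
  qed
qed

lemma card_gball_step:
  "card (gball (Suc (Suc n))) + (2 * CARD('x) - 1) * card (gball n)
    \<le> ((2 * CARD('x) - 1) + 1) * card (gball (Suc n))"
proof -
  let ?T = "gball (Suc n) - gball n"
  obtain U where U: "finite U" "card U \<le> (2 * CARD('x) - 1) * card ?T"
    "\<And>s l. s \<in> ?T \<Longrightarrow> act s (letter_elem l) \<in> gball (Suc n) \<union> U"
    using new_elements[OF order_refl] by blast
  \<comment> \<open>One letter takes an element of \<open>gball n\<close> no further than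
    \<open>gball (Suc n)\<close>, so only elements of \<open>?T\<close> can produce anything new,
    and their images are controlled by \<open>U\<close>.\<close>
  have "gball (Suc (Suc n)) \<subseteq> gball (Suc n) \<union> U"
  proof
    fix s assume "s \<in> gball (Suc (Suc n))"
    then show "s \<in> gball (Suc n) \<union> U"
    proof (cases rule: gball_Suc_cases)
      case (2 t l)
      then show ?thesis
        using U(3)[of t l] gball_act[OF _ letter_elem_in_word_ball, of t n l] by auto
    qed simp
  qed
  then have "card (gball (Suc (Suc n))) \<le> card (gball (Suc n)) + card U"
    using card_mono[of "gball (Suc n) \<union> U"] U(1) finite_gball card_Un_le order_trans
    by (metis finite_UnI)
  moreover have "card ?T = card (gball (Suc n)) - card (gball n)"
    by (simp add: act_ball_mono card_Diff_subset finite_gball)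
  moreover have "card (gball n) \<le> card (gball (Suc n))"
    by (simp add: act_ball_mono card_mono finite_gball)
  ultimately show ?thesis
    using increment_bound U(2) by metis
qed

text \<open>A finite set lies in a single ball, of radius \<open>m\<close> say, and acting by words
  of length at most \<open>n\<close> adds at most \<open>n\<close> to the radius. For empty
  \<open>A'\<close> the value of \<open>Max\<close> is unspecified, but then there is nothing to
  check.\<close>

lemma gball_shift_subset:
  assumes A': "finite A'" "A' \<subseteq> (\<Union>n. gball n)"
  shows "\<exists>C. \<forall>n. act_ball act A' n \<subseteq> gball (n + C)"
proof -
  have "\<forall>a\<in>A'. \<exists>k. a \<in> gball k" using A'(2) by blast
  then obtain k where k: "\<And>a. a \<in> A' \<Longrightarrow> a \<in> gball (k a)" by metis
  define m where "m = Max (k ` A')"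
  have "act a u \<in> gball (n + m)" if "a \<in> A'" "u \<in> word_ball n" for a u n
  proof -
    have "k a \<le> m" using that(1) A'(1) by (simp add: m_def)
    then have "a \<in> gball m"
        using k[OF that(1)] act_ball_mono[of "k a" m act A] by blast
    then show ?thesis using gball_act[OF _ that(2)] by (simp add: add.commute)
  qed
  then have "act_ball act A' n \<subseteq> gball (n + m)" for n
    unfolding act_ball_def[of act A'] by blast
  then show ?thesis by blast
qed

lemma generated_eq_Union_gball:
  assumes "act_generates S act A"
  shows "S = (\<Union>n. gball n)"
proof -
  have S: "S = {act a u | a u. a \<in> A}" using assms by (simp only: act_generates_def)
  show ?thesis
  proof (rule equalityI)
    show "S \<subseteq> (\<Union>n. gball n)"
    proof
      fix s assume "s \<in> S"
      then obtain a u where "a \<in> A" "s = act a u" unfolding S by blast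
      then have "s \<in> gball (length (reduced_word u))"
        by (simp add: act_ballI word_ball_def)
      then show "s \<in> (\<Union>n. gball n)" by blast
    qed
  qed (use gball_subset in blast)
qed

end

section \<open>Growth and limit for acts\<close>

lemma act_growth_fun_eq: "act_growth_fun act A n = card (act_ball act A n)"
  by (simp add: act_growth_fun_def act_ball_def)

lemma free_group_actI:
  assumes "right_act S act" "finite A \<and> act_generates S act A"
  shows "free_group_act S act A"
  using assms unfolding free_group_act_def free_group_act_axioms_def act_generates_def by blast

lemma act_growth_fun_bounded:
  fixes act :: "'s \<Rightarrow> 'x::finite free_group \<Rightarrow> 's"
  assumes "right_act S act" "finite A \<and> act_generates S act A" "finite A' \<and> act_generates S act A'"
  shows "\<exists>C. \<forall>n. act_growth_fun act A' n \<le> act_growth_fun act A (n + C)"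
proof -
  interpret free_group_act S act A using assms by (intro free_group_actI)
  have "S = (\<Union>n. gball n)"
    using assms(2) generated_eq_Union_gball by blast
  moreover have "A' \<subseteq> S" using assms(3) unfolding act_generates_def by blast
  ultimately obtain C where "\<And>n. act_ball act A' n \<subseteq> gball (n + C)"
    using gball_shift_subset[of A'] assms(3) by blast
  then show ?thesis
    unfolding act_growth_fun_eq using card_mono[OF finite_gball] by blast
qed

lemma act_growth_fun_equiv:
  fixes act :: "'s \<Rightarrow> 'x::finite free_group \<Rightarrow> 's"
  assumes "right_act S act" "finite A \<and> act_generates S act A" "finite A' \<and> act_generates S act A'"
  shows "growth_equiv (act_growth_fun act A) (act_growth_fun act A')"
  using act_growth_fun_bounded[OF assms] act_growth_fun_bounded[OF assms(1,3,2)]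
  unfolding growth_equiv_def by blast

lemma act_growth_fun_convergent:
  fixes act :: "'s \<Rightarrow> 'x::finite free_group \<Rightarrow> 's"
  assumes "right_act S act" "finite A \<and> act_generates S act A" "CARD('x) > 1"
  shows "convergent (\<lambda>n. real (act_growth_fun act A n) / real (2 * CARD('x) - 1) ^ n)"
proof -
  interpret free_group_act S act A using assms by (intro free_group_actI)
  show ?thesis
    unfolding act_growth_fun_eq
    using assms(3) by (intro normalized_growth_convergent card_gball_step) linarith
qed

lemma regular_act_generates: "act_generates UNIV (+) {0 :: 'x free_group}"
  by (auto simp: act_generates_def)

lemma act_growth_fun_regular: "act_growth_fun (+) {0 :: 'x free_group} n = card (word_ball n :: 'x free_group set)"
  by (simp add: act_growth_fun_def)

lemma act_growth_limit:
  fixes act :: "'s \<Rightarrow> 'x::finite free_group \<Rightarrow> 's"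
  assumes act: "right_act S act" and A: "finite A \<and> act_generates S act A" and r: "CARD('x) > 1"
  shows "\<exists>C. (\<lambda>n. real (act_growth_fun act A n) / real (2 * CARD('x) - 1) ^ n) \<longlonglongrightarrow> C \<and>
    (maximal_act_growth S act \<longleftrightarrow> C > 0)"
proof -
  let ?q = "2 * CARD('x) - 1"
  have q: "?q > 1" using r by simp
  let ?b = "act_growth_fun (+) {0 :: 'x free_group}"
  interpret free_group_act S act A using act A by (rule free_group_actI)
  have reg: "finite {0 :: 'x free_group} \<and> act_generates UNIV (+) {0 :: 'x free_group}"
    by (simp add: regular_act_generates)
  obtain C where C: "(\<lambda>n. real (act_growth_fun act A n) / real ?q ^ n) \<longlonglongrightarrow> C"
    using act_growth_fun_convergent[OF act A r] by (auto simp: convergent_def)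
  obtain D where D: "(\<lambda>n. real (?b n) / real ?q ^ n) \<longlonglongrightarrow> D"
    using act_growth_fun_convergent[OF right_act_regular reg r] by (auto simp: convergent_def)
  have "D > 0"
    using q card_word_ball_ge by (intro limit_pos_of_power_le[OF _ _ D]) (auto simp: act_growth_fun_regular)
  have "mono (act_growth_fun act A)"
    unfolding act_growth_fun_eq[abs_def] by (intro monoI card_mono finite_gball act_ball_mono)
  \<comment> \<open>Reassociating the conjunction makes "finite and generating" a single predicate,
    as \<open>growth_class_eq_iff\<close> expects. The regular act is represented by its generator
    \<open>0\<close>, the empty word.\<close>
  then have "maximal_act_growth S act \<longleftrightarrow> growth_equiv (act_growth_fun act A) ?b"
    unfolding maximal_act_growth_def act_growth_def conj_assoc[symmetric, of "finite _"]
    using A reg act_growth_fun_equiv[OF act] act_growth_fun_equiv[OF right_act_regular]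
    by (intro growth_class_eq_iff) blast+
  then show ?thesis
    using C growth_equiv_iff_limit_pos[OF q C D \<open>D > 0\<close>] by blast
qed

section \<open>Modules\<close>

text \<open>Restricting the module action to group elements makes the underlying set an act of the
  free group, so the counting done for acts carries over.\<close>

definition translate ::
    "('m \<Rightarrow> ('x, 'k::field) free_group_algebra \<Rightarrow> 'm) \<Rightarrow> 'm \<Rightarrow> 'x free_group \<Rightarrow> 'm"
  where "translate act x w = act x (Poly_Mapping.single w 1)"

text \<open>A finitely supported function is a finite sum of functions supported at one
  point.\<close>

lemma poly_mapping_single_induct [case_names single add]:
  fixes a :: "'g \<Rightarrow>\<^sub>0 'k::comm_monoid_add"
  assumes single: "\<And>w c. P (Poly_Mapping.single w c)" and add: "\<And>a b. P a \<Longrightarrow> P b \<Longrightarrow> P (a + b)"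
  shows "P a"
proof (induction a rule: update_induct)
  case const
  \<comment> \<open>The zero function is the single with coefficient \<open>0\<close> at any
    key.\<close>
  show ?case using single[of undefined 0] by simp
next
  case (update a w c)
  \<comment> \<open>The key \<open>w\<close> is fresh for \<open>a\<close>, so updating there
    amounts to adding.\<close>
  have "Poly_Mapping.update w c a = Poly_Mapping.single w c + a"
    using update.hyps
    by (intro poly_mapping_eqI)
      (auto simp: lookup_add lookup_single lookup_update when_def in_keys_iff)
  then show ?case using update.IH single add by simp
qed

locale free_group_module = right_module act
  for act :: "'m::ab_group_add \<Rightarrow> ('x::finite, 'k::field) free_group_algebra \<Rightarrow> 'm" +
  fixes A :: "'m set"
  assumes finite_gens: "finite A"
begin

sublocale vs: vector_space "field_scale act"
  by (rule vector_space_field_scale) unfold_locales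

sublocale alg: vector_space "field_scale ((*) :: ('x, 'k) free_group_algebra \<Rightarrow> _)"
  by (rule vector_space_field_scale[OF right_module_regular])

sublocale tr: free_group_act UNIV "translate act" A
proof
  show "translate act s (u + v) = translate act (translate act s u) v" for s u v
    by (simp add: translate_def mult_single flip: act_mult)
  show "translate act s 0 = s" for s
    by (simp add: translate_def act_one)
qed (simp_all add: finite_gens)

abbreviation "gspan n \<equiv> vs.span (tr.gball n)"

lemma act_zero_left: "act 0 a = 0"
  using act_add_left[of 0 0 a] by simp

lemma act_zero_right: "act x 0 = 0"
  using act_add_right[of x 0 0] by simp

lemma act_single: "act x (Poly_Mapping.single w c) = field_scale act c (translate act x w)"
  by (simp add: field_scale_def translate_def mult_single flip: act_mult)

lemma act_algebra_scale: "act x (field_scale (*) c a) = field_scale act c (act x a)"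
  by (simp add: field_scale_def act_mult)

lemma translate_scale: "translate act (field_scale act c x) w = field_scale act c (translate act x w)"
  by (simp add: field_scale_def translate_def mult_single flip: act_mult)

text \<open>Translation by a fixed group element is linear, so it suffices to look at a spanning
  set.\<close>

lemma translate_in_span:
  assumes "x \<in> vs.span X" and "\<And>y. y \<in> X \<Longrightarrow> translate act y w \<in> vs.span Y"
  shows "translate act x w \<in> vs.span Y"
  using assms(1)
proof (induction rule: vs.span_induct_alt)
  case base
  show ?case using act_zero_left vs.span_zero by (simp add: translate_def)
next
  case (step c x y)
  have "translate act (field_scale act c x + y) w = field_scale act c (translate act x w) + translate act y w"
    using translate_scale by (simp add: translate_def act_add_left)
  then show ?case using step assms(2) by (simp add: vs.span_add vs.span_scale)
qed

text \<open>Words of length at most \<open>n\<close> span \<open>algebra_ball n\<close>, so the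
  finite set \<open>A F(n)\<close> spans the same space as all products of generators with elements
  of \<open>algebra_ball n\<close>. This reduces module growth to dimensions spanned by the balls of
  an act.\<close>

lemma module_growth_fun_eq: "module_growth_fun act A n = vs.dim (tr.gball n)"
proof -
  let ?W = "{act a v | a v. a \<in> A \<and> v \<in> algebra_ball n}"
  have "act a v \<in> gspan n" if "a \<in> A" "v \<in> algebra_ball n" for a v
    using that(2) unfolding algebra_ball_def
  proof (induction rule: alg.span_induct_alt)
    case base
    show ?case by (simp add: act_zero_right vs.span_zero)
  next
    case (step c x y)
    from step.hyps obtain w where "w \<in> word_ball n" "x = Poly_Mapping.single w 1"
      by (rule imageE)
    then have "act a x \<in> tr.gball n"
      using act_ballI[OF \<open>a \<in> A\<close>, of w n "translate act"] by (simp add: translate_def)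
    then have "act a x \<in> gspan n" by (rule vs.span_base)
    then show ?case
      using step.IH by (simp add: act_add_right act_algebra_scale vs.span_add vs.span_scale)
  qed
  then have "?W \<subseteq> gspan n" by (intro subsetI) (elim CollectE exE conjE, simp)
  then have "vs.span ?W \<subseteq> gspan n"
    by (rule vs.span_minimal) (rule vs.subspace_span)
  moreover have "tr.gball n \<subseteq> ?W"
  proof
    fix x assume "x \<in> tr.gball n"
    then obtain a w where "a \<in> A" "w \<in> word_ball n" "x = act a (Poly_Mapping.single w 1)"
      by (auto simp: act_ball_def translate_def)
    moreover from \<open>w \<in> word_ball n\<close> have "Poly_Mapping.single w (1::'k) \<in> algebra_ball n"
      unfolding algebra_ball_def by (intro alg.span_base imageI)
    ultimately show "x \<in> ?W" by (intro CollectI exI conjI)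
  qed
  ultimately have "vs.span ?W = gspan n"
    by (rule equalityI[OF _ vs.span_mono])
  then show ?thesis
    by (simp only: module_growth_fun_def vs.dim_span)
qed

text \<open>The module may be infinite-dimensional, so monotonicity of the dimension is obtained
  through a finite basis \<open>Y\<close> chosen inside the ball.\<close>

lemma dim_gball_le:
  assumes "finite X" "X \<subseteq> gspan n"
  shows "vs.dim X \<le> vs.dim (tr.gball n)"
proof -
  obtain Y where "Y \<subseteq> tr.gball n" "tr.gball n \<subseteq> vs.span Y" "card Y = vs.dim (tr.gball n)"
    by (metis vs.basis_exists)
  moreover have "finite Y" by (rule finite_subset[OF calculation(1) tr.finite_gball])
  moreover have "X \<subseteq> vs.span Y"
    by (rule order_trans[OF assms(2) vs.span_minimal[OF calculation(2) vs.subspace_span]])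
  ultimately show ?thesis using vs.dim_le_card[of X Y] by simp
qed

text \<open>A basis \<open>X\<close> of the span at radius \<open>n\<close>, taken from the ball
  itself, is extended to a basis \<open>Y\<close> at radius \<open>n+1\<close> within the larger
  ball. The added vectors are elements of an act, so \<open>new_elements\<close> applies to them,
  and \<open>Y\<close> with the resulting \<open>U\<close> spans the ball of radius
  \<open>n+2\<close>.\<close>

lemma dim_gball_step:
  "vs.dim (tr.gball (Suc (Suc n))) + (2 * CARD('x) - 1) * vs.dim (tr.gball n)
    \<le> ((2 * CARD('x) - 1) + 1) * vs.dim (tr.gball (Suc n))"
proof -
  obtain X where X: "X \<subseteq> tr.gball n" "vs.independent X" "tr.gball n \<subseteq> vs.span X"
    "card X = vs.dim (tr.gball n)"
    by (metis vs.basis_exists)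
  moreover have "X \<subseteq> tr.gball (Suc n)"
    using X(1) act_ball_mono[of n "Suc n" "translate act" A] by simp
  ultimately obtain Y where Y: "X \<subseteq> Y" "Y \<subseteq> tr.gball (Suc n)" "vs.independent Y"
    "tr.gball (Suc n) \<subseteq> vs.span Y"
    using vs.maximal_independent_subset_extend[of X "tr.gball (Suc n)"] by metis
  have finY: "finite Y" by (rule finite_subset[OF Y(2) tr.finite_gball])
  have cardY: "card Y = vs.dim (tr.gball (Suc n))"
    using vs.dim_unique[OF Y(2,4,3) refl] by simp
  \<comment> \<open>A vector of \<open>Y - X\<close> inside the smaller ball would lie in the span
    of \<open>X\<close>, hence of the other members of \<open>Y\<close>, against
    independence.\<close>
  have disj: "Y - X \<subseteq> tr.gball (Suc n) - tr.gball n"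
  proof
    fix y assume y: "y \<in> Y - X"
    have "y \<notin> tr.gball n"
    proof
      assume "y \<in> tr.gball n"
      then have "y \<in> vs.span X" using X(3) by (rule rev_subsetD)
      moreover have "X \<subseteq> Y - {y}" using y Y(1) by blast
      ultimately have "y \<in> vs.span (Y - {y})" by (meson subsetD vs.span_mono)
      then show False using Y(3) y unfolding vs.dependent_def by blast
    qed
    with y Y(2) show "y \<in> tr.gball (Suc n) - tr.gball n" by blast
  qed
  obtain U where U: "finite U" "card U \<le> (2 * CARD('x) - 1) * card (Y - X)"
    "\<And>s l. s \<in> Y - X \<Longrightarrow> translate act s (letter_elem l) \<in> tr.gball (Suc n) \<union> U"
    using tr.new_elements[OF disj] by blast
  have sub: "tr.gball (Suc n) \<union> U \<subseteq> vs.span (Y \<union> U)"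
  proof (rule Un_least)
    show "tr.gball (Suc n) \<subseteq> vs.span (Y \<union> U)"
      by (rule order_trans[OF Y(4) vs.span_mono]) simp
    show "U \<subseteq> vs.span (Y \<union> U)"
      by (rule order_trans[OF _ vs.span_superset]) simp
  qed
  have "tr.gball (Suc (Suc n)) \<subseteq> vs.span (Y \<union> U)"
  proof
    fix s assume "s \<in> tr.gball (Suc (Suc n))"
    then show "s \<in> vs.span (Y \<union> U)"
    proof (cases rule: tr.gball_Suc_cases)
      case 1
      then show ?thesis using sub by blast
    next
      case (2 t l)
      \<comment> \<open>By linearity only basis vectors need checking: a letter keeps those of
        \<open>X\<close> within radius \<open>n+1\<close>, and \<open>U\<close> takes care of the
        others.\<close>
      have "translate act y (letter_elem l) \<in> vs.span (Y \<union> U)" if "y \<in> Y" for y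
      proof (cases "y \<in> X")
        case True
        then have "translate act y (letter_elem l) \<in> tr.gball (Suc n)"
          using X(1) tr.gball_act[OF _ letter_elem_in_word_ball, of y n l]
          by (simp add: subset_iff)
        then show ?thesis using sub by (meson UnI1 subsetD)
      next
        case False
        with that have "translate act y (letter_elem l) \<in> tr.gball (Suc n) \<union> U"
          by (intro U(3)) simp
        then show ?thesis using sub by (rule rev_subsetD)
      qed
      moreover have "t \<in> vs.span Y" using 2(1) Y(4) by (rule rev_subsetD)
      ultimately show ?thesis unfolding 2(2) by (rule translate_in_span[rotated])
    qed
  qed
  then have "vs.dim (tr.gball (Suc (Suc n))) \<le> card (Y \<union> U)"
    by (rule vs.dim_le_card) (simp add: finY U(1))
  also have "\<dots> \<le> card Y + card U" by (rule card_Un_le)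
  finally have "vs.dim (tr.gball (Suc (Suc n))) \<le> card Y + card U" .
  moreover have "card (Y - X) = card Y - card X" "card X \<le> card Y"
    using card_Diff_subset[OF finite_subset[OF Y(1) finY] Y(1)] card_mono[OF finY Y(1)] by simp_all
  ultimately show ?thesis
    unfolding X(4) cardY using U(2) by (intro increment_bound[of _ _ "card U"]) (simp_all only: X(4) cardY)
qed

lemma gspan_mono: "m \<le> n \<Longrightarrow> gspan m \<subseteq> gspan n"
  by (intro vs.span_mono act_ball_mono)

text \<open>The spans are nested, so a sum lives at the larger of two radii. For the action, an
  algebra element is decomposed into multiples of group elements, and a word of length
  \<open>m\<close> raises the radius by at most \<open>m\<close>.\<close>

lemma Union_gspan_submodule: "right_submodule act (\<Union>n. gspan n)"
  unfolding right_submodule_def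
proof (intro conjI ballI allI)
  show "0 \<in> (\<Union>n. gspan n)" by (intro UN_I[OF UNIV_I] vs.span_zero)
next
  fix x y assume "x \<in> (\<Union>n. gspan n)" "y \<in> (\<Union>n. gspan n)"
  then obtain m n where mn: "x \<in> gspan m" "y \<in> gspan n" by (elim UN_E)
  have "x \<in> gspan (max m n)" "y \<in> gspan (max m n)"
    using mn by (meson gspan_mono max.cobounded1 max.cobounded2 subsetD)+
  then show "x + y \<in> (\<Union>n. gspan n)"
    by (intro UN_I[OF UNIV_I] vs.span_add)
next
  fix x a assume "x \<in> (\<Union>n. gspan n)"
  then obtain n where x: "x \<in> gspan n" by (elim UN_E)
  have "\<exists>m. act x a \<in> gspan m"
  proof (induction a rule: poly_mapping_single_induct)
    case (single w c)
    have w: "w \<in> word_ball (length (reduced_word w))" by (simp add: word_ball_def)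
    have "translate act x w \<in> gspan (n + length (reduced_word w))"
      by (rule translate_in_span[OF x]) (rule vs.span_base, rule tr.gball_act[OF _ w])
    then show ?case unfolding act_single by (intro exI vs.span_scale)
  next
    case (add a b)
    then obtain i j where ij: "act x a \<in> gspan i" "act x b \<in> gspan j" by (elim exE)
    have "act x a \<in> gspan (max i j)" "act x b \<in> gspan (max i j)"
      using ij by (meson gspan_mono max.cobounded1 max.cobounded2 subsetD)+
    then show ?case unfolding act_add_right by (intro exI vs.span_add)
  qed
  then show "act x a \<in> (\<Union>n. gspan n)" by (elim exE) (rule UN_I[OF UNIV_I])
qed

text \<open>The union is a submodule containing \<open>A\<close>, which sits in the ball of radius
  \<open>0\<close>; minimality of the hull does the rest.\<close>

lemma generated_eq_Union_gspan:
  assumes "module_generates act A"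
  shows "(\<Union>n. gspan n) = UNIV"
proof -
  have "A \<subseteq> (\<Union>n. gspan n)"
  proof
    fix a assume "a \<in> A"
    from act_ballI[OF this zero_in_word_ball, of "translate act" 0]
    have "a \<in> tr.gball 0" by (simp add: tr.act_zero)
    then show "a \<in> (\<Union>n. gspan n)" by (intro UN_I[OF UNIV_I] vs.span_base)
  qed
  then have "right_submodule act hull A \<subseteq> (\<Union>n. gspan n)"
    using Union_gspan_submodule by (rule hull_minimal)
  then show ?thesis using assms unfolding module_generates_def by (simp add: top_unique)
qed

lemma gspan_shift_subset:
  assumes "module_generates act A" "finite A'"
  shows "\<exists>C. \<forall>n. act_ball (translate act) A' n \<subseteq> gspan (n + C)"
proof -
  have "\<forall>a. \<exists>k. a \<in> gspan k"
    using generated_eq_Union_gspan[OF assms(1)] by (metis UNIV_I UN_E)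
  then obtain k where k: "\<And>a. a \<in> gspan (k a)" by metis
  have "translate act a w \<in> gspan (n + Max (k ` A'))" if "a \<in> A'" "w \<in> word_ball n" for a w n
  proof -
    have "a \<in> gspan (Max (k ` A'))"
      using k[of a] gspan_mono[of "k a" "Max (k ` A')"] that(1) assms(2) by auto
    then show ?thesis
      by (rule translate_in_span)
        (metis add.commute that(2) tr.gball_act vs.span_base)
  qed
  then have "act_ball (translate act) A' n \<subseteq> gspan (n + Max (k ` A'))" for n
    unfolding act_ball_def[of _ A'] by blast
  then show ?thesis by blast
qed

end

section \<open>Growth and limit for modules\<close>

lemma free_group_moduleI:
  assumes "right_module act" "finite A \<and> module_generates act A"
  shows "free_group_module act A"
  using assms by (simp add: free_group_module_def free_group_module_axioms_def)

lemma module_growth_fun_bounded: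
  fixes act :: "'m::ab_group_add \<Rightarrow> ('x::finite, 'k::field) free_group_algebra \<Rightarrow> 'm"
  assumes "right_module act" "finite A \<and> module_generates act A" "finite A' \<and> module_generates act A'"
  shows "\<exists>C. \<forall>n. module_growth_fun act A' n \<le> module_growth_fun act A (n + C)"
proof -
  interpret free_group_module act A using assms by (intro free_group_moduleI)
  interpret A': free_group_module act A' using assms by (intro free_group_moduleI)
  obtain C where "\<And>n. A'.tr.gball n \<subseteq> gspan (n + C)"
    using gspan_shift_subset assms by blast
  then show ?thesis
    unfolding module_growth_fun_eq A'.module_growth_fun_eq
    using dim_gball_le[OF A'.tr.finite_gball] by blast
qed

lemma module_growth_fun_equiv:
  fixes act :: "'m::ab_group_add \<Rightarrow> ('x::finite, 'k::field) free_group_algebra \<Rightarrow> 'm"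
  assumes "right_module act" "finite A \<and> module_generates act A" "finite A' \<and> module_generates act A'"
  shows "growth_equiv (module_growth_fun act A) (module_growth_fun act A')"
  using module_growth_fun_bounded[OF assms] module_growth_fun_bounded[OF assms(1,3,2)]
  unfolding growth_equiv_def by blast

lemma module_growth_fun_convergent:
  fixes act :: "'m::ab_group_add \<Rightarrow> ('x::finite, 'k::field) free_group_algebra \<Rightarrow> 'm"
  assumes "right_module act" "finite A \<and> module_generates act A" "CARD('x) > 1"
  shows "convergent (\<lambda>n. real (module_growth_fun act A n) / real (2 * CARD('x) - 1) ^ n)"
proof -
  interpret free_group_module act A using assms by (intro free_group_moduleI)
  show ?thesis
    unfolding module_growth_fun_eq
    using assms(3) by (intro normalized_growth_convergent dim_gball_step) linarith
qed

lemma regular_module_generates: "module_generates (*) {1 :: 'a::ring_1}"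
proof -
  have "a \<in> N" if "right_submodule (*) N" "1 \<in> N" for a :: 'a and N
    using that unfolding right_submodule_def by (metis mult_1)
  then show ?thesis by (auto simp: module_generates_def hull_def)
qed

text \<open>The group elements are linearly independent in the group algebra, so the dimension is a
  count of words.\<close>

lemma module_growth_fun_regular:
  "module_growth_fun (*) {1 :: ('x::finite, 'k::field) free_group_algebra} n
    = card (word_ball n :: 'x free_group set)"
proof -
  let ?s = "\<lambda>w :: 'x free_group. Poly_Mapping.single w (1 :: 'k)"
  interpret free_group_module "(*)" "{1 :: ('x, 'k) free_group_algebra}"
    by (intro free_group_moduleI right_module_regular) (simp add: regular_module_generates)
  have ball: "tr.gball n = ?s ` word_ball n"
    by (auto simp: act_ball_def translate_def)
  have inj: "inj ?s"
    by (rule injI) (metis lookup_single_eq lookup_single_not_eq one_neq_zero)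
  have "vs.independent (?s ` word_ball n)"
  proof (rule vs.independent_if_scalars_zero)
    show "finite (?s ` word_ball n)" by (simp add: finite_word_ball)
  next
    fix f x
    assume "(\<Sum>x\<in>?s ` word_ball n. field_scale (*) (f x) x) = 0" and x: "x \<in> ?s ` word_ball n"
    then have "(\<Sum>w\<in>word_ball n. Poly_Mapping.single w (f (?s w))) = 0"
      using inj by (simp add: sum.reindex inj_on_subset[OF inj] field_scale_def mult_single)
    moreover from x obtain v where v: "v \<in> word_ball n" "x = ?s v" by blast
    \<comment> \<open>Reading off the coefficient at \<open>v\<close> leaves only the scalar
      belonging to \<open>v\<close>.\<close>
    ultimately have "(\<Sum>w\<in>word_ball n. Poly_Mapping.lookup (Poly_Mapping.single w (f (?s w))) v) = 0"
      by (metis lookup_sum lookup_zero)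
    then show "f x = 0"
      using v by (simp add: lookup_single when_def finite_word_ball)
  qed
  then have "vs.dim (?s ` word_ball n) = card (?s ` word_ball n)"
    by (rule vs.dim_eq_card_independent)
  then show ?thesis
    unfolding module_growth_fun_eq ball by (simp add: card_image inj_on_subset[OF inj])
qed

lemma module_growth_limit:
  fixes act :: "'m::ab_group_add \<Rightarrow> ('x::finite, 'k::field) free_group_algebra \<Rightarrow> 'm"
  assumes act: "right_module act" and A: "finite A \<and> module_generates act A" and r: "CARD('x) > 1"
  shows "\<exists>C. (\<lambda>n. real (module_growth_fun act A n) / real (2 * CARD('x) - 1) ^ n) \<longlonglongrightarrow> C \<and>
    (maximal_module_growth act \<longleftrightarrow> C > 0)"
proof -
  let ?q = "2 * CARD('x) - 1"
  have q: "?q > 1" using r by simp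
  let ?b = "module_growth_fun (*) {1 :: ('x, 'k) free_group_algebra}"
  interpret free_group_module act A using act A by (rule free_group_moduleI)
  have reg: "finite {1 :: ('x, 'k) free_group_algebra}
      \<and> module_generates (*) {1 :: ('x, 'k) free_group_algebra}"
    by (simp add: regular_module_generates)
  obtain C where C: "(\<lambda>n. real (module_growth_fun act A n) / real ?q ^ n) \<longlonglongrightarrow> C"
    using module_growth_fun_convergent[OF act A r] by (auto simp: convergent_def)
  obtain D where D: "(\<lambda>n. real (?b n) / real ?q ^ n) \<longlonglongrightarrow> D"
    using module_growth_fun_convergent[OF right_module_regular reg r] by (auto simp: convergent_def)
  have "D > 0"
    using q card_word_ball_ge by (intro limit_pos_of_power_le[OF _ _ D]) (auto simp: module_growth_fun_regular)
  have "mono (module_growth_fun act A)"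
    unfolding module_growth_fun_eq[abs_def]
    by (intro monoI dim_gball_le tr.finite_gball order_trans[OF act_ball_mono vs.span_superset])
  then have "maximal_module_growth act \<longleftrightarrow> growth_equiv (module_growth_fun act A) ?b"
    unfolding maximal_module_growth_def module_growth_def conj_assoc[symmetric, of "finite _"]
    using A reg module_growth_fun_equiv[OF act] module_growth_fun_equiv[OF right_module_regular]
    by (intro growth_class_eq_iff) blast+
  then show ?thesis
    using C growth_equiv_iff_limit_pos[OF q C D \<open>D > 0\<close>] by blast
qed

theorem lemma6:
  fixes r :: nat
    and S :: "'s set" and act :: "'s \<Rightarrow> 'x::finite free_group \<Rightarrow> 's" and A :: "'s set"
    and mact :: "'m::ab_group_add \<Rightarrow> ('x, 'k::field) free_group_algebra \<Rightarrow> 'm" and B :: "'m set"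
  assumes "r = CARD('x)" and "r > 1"
  shows "(right_act S act \<and> finite A \<and> act_generates S act A \<longrightarrow>
           (\<exists>C\<^sub>0::real.
             (\<lambda>n. real (act_growth_fun act A n) / (2 * real r - 1) ^ n) \<longlonglongrightarrow> C\<^sub>0 \<and>
             (maximal_act_growth S act \<longleftrightarrow> C\<^sub>0 > 0))) \<and>
         (right_module mact \<and> finite B \<and> module_generates mact B \<longrightarrow>
           (\<exists>C\<^sub>0::real.
             (\<lambda>n. real (module_growth_fun mact B n) / (2 * real r - 1) ^ n) \<longlonglongrightarrow> C\<^sub>0 \<and>
             (maximal_module_growth mact \<longleftrightarrow> C\<^sub>0 > 0)))"
proof -
  \<comment> \<open>The lemmas above subtract in the natural numbers and the statement in the reals;
    the two agree because \<open>2 * CARD('x)\<close> is at least \<open>1\<close>.\<close>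
  have "real (2 * CARD('x) - 1) = 2 * real r - 1"
    using assms by simp
  then show ?thesis
    using act_growth_limit[of S act A] module_growth_limit[of mact B] assms by auto
qed

end
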